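(* Let $k,p\ge1$ and let $x_1\dots x_k,\ y_1\dots y_p\in\mathbb{Z}^*$ be words with $x_k\neq y_p$. Then the group $\mathcal{K}(x_1\dots x_k,y_1\dots y_p)$ is not residually finite.
   Context: **The group $\mathcal{K}$.** $\mathbb{Z}^*$ is the set of finite words over the alphabet $\mathbb{Z}$, regarded as a rooted tree: the root is the empty word $\emptyset$ and the children of $v$ are the words $vn$, $n\in\mathbb{Z}$. Given words $x_1\dots x_k,\ y_1\dots y_p$ with $x_k\ne y_p$, the kneading automaton has states $a_1,\dots,a_k,b_1,\dots,b_p$ and an identity state $\mathbf{1}$, and transition function $\tau(q,z)=(q(z),q|_z)$ for a state $q$ and $z\in\mathbb{Z}$, given by: $\tau(a_1,z)=(z+1,\mathbf{1})$ for all $z$; $\tau(a_{i+1},x_i)=(x_i,a_i)$ for $1\le i\le k-1$; $\tau(b_1,x_k)=(x_k,a_k)$; $\tau(b_1,y_p)=(y_p,b_p)$; $\tau(b_{j+1},y_j)=(y_j,b_j)$ for $1\le j\le p-1$; and $\tau(q,z)=(z,\mathbf{1})$ in all other cases. Each state acts on $\mathbb{Z}^*$ by a rooted tree automorphism via $q(\emptyset)=\emptyset$, $q(zv)=q(z)\,(q|_z)(v)$ for $z\in\mathbb{Z}$, $v\in\mathbb{Z}^*$. $\mathcal{K}(x_1\dots x_k,y_1\dots y_p)$ is the group of automorphisms of $\mathbb{Z}^*$ generated by $a_1,\dots,a_k,b_1,\dots,b_p$. *)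

theory Defs
  imports "HOL-Algebra.Algebra"
begin

definition residually_finite :: "('a, 'b) monoid_scheme \<Rightarrow> bool" where
  "residually_finite G \<longleftrightarrow>
     group G \<and>
     (\<forall>g \<in> carrier G. g \<noteq> \<one>\<^bsub>G\<^esub> \<longrightarrow>
       (\<exists>N. N \<lhd> G \<and> finite (rcosets\<^bsub>G\<^esub> N) \<and> g \<notin> N))"

definition tree_aut_group :: "(int list \<Rightarrow> int list) monoid" where
  "tree_aut_group =
     \<lparr>carrier = {f. bij f \<and> f [] = [] \<and>
        (\<forall>u v. (\<exists>n. v = u @ [n]) \<longleftrightarrow> (\<exists>n. f v = f u @ [n]))},
      monoid.mult = (\<circ>), one = id\<rparr>"

(* Indices are zero-based: StateA i and StateB j stand for a_{i+1} and b_{j+1}. The kneading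
   automaton has the states StateA i (i < k), StateB j (j < p) and Trivial; this set is closed
   under tau, so the remaining values play no role. *)
datatype state = StateA nat | StateB nat | Trivial

fun tau :: "int list \<Rightarrow> int list \<Rightarrow> state \<Rightarrow> int \<Rightarrow> int \<times> state" where
  "tau xs ys (StateA 0) z = (z + 1, Trivial)"
| "tau xs ys (StateA (Suc i)) z = (z, if z = xs ! i then StateA i else Trivial)"
| "tau xs ys (StateB 0) z =
     (z, if z = last xs then StateA (length xs - 1)
         else if z = last ys then StateB (length ys - 1) else Trivial)"
| "tau xs ys (StateB (Suc j)) z = (z, if z = ys ! j then StateB j else Trivial)"
| "tau xs ys Trivial z = (z, Trivial)"

fun act :: "int list \<Rightarrow> int list \<Rightarrow> state \<Rightarrow> int list \<Rightarrow> int list" where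
  "act xs ys q [] = []"
| "act xs ys q (z # v) = fst (tau xs ys q z) # act xs ys (snd (tau xs ys q z)) v"

definition kneading_states :: "int list \<Rightarrow> int list \<Rightarrow> state set" where
  "kneading_states xs ys = StateA ` {..<length xs} \<union> StateB ` {..<length ys}"

definition kneading_group :: "int list \<Rightarrow> int list \<Rightarrow> (int list \<Rightarrow> int list) monoid" where
  "kneading_group xs ys =
     tree_aut_group
       \<lparr>carrier := generate tree_aut_group (act xs ys ` kneading_states xs ys)\<rparr>"

lemma group_tree_aut_group: "group tree_aut_group"
proof (rule groupI)
  fix f g assume "f \<in> carrier tree_aut_group" "g \<in> carrier tree_aut_group"
  then show "f \<otimes>\<^bsub>tree_aut_group\<^esub> g \<in> carrier tree_aut_group"
    by (auto simp: tree_aut_group_def bij_comp)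
next
  fix f assume f: "f \<in> carrier tree_aut_group"
  then have b: "bij f" by (simp add: tree_aut_group_def)
  have r: "f (inv_into UNIV f v) = v" for v
    using b by (simp add: bij_is_surj surj_f_inv_f)
  have "inv_into UNIV f [] = []"
    using f b by (auto simp: tree_aut_group_def intro!: inv_f_eq bij_is_inj)
  moreover have "(\<exists>n. v = u @ [n]) \<longleftrightarrow> (\<exists>n. inv_into UNIV f v = inv_into UNIV f u @ [n])" for u v
  proof -
    have "(\<exists>n. inv_into UNIV f v = inv_into UNIV f u @ [n]) \<longleftrightarrow>
        (\<exists>n. f (inv_into UNIV f v) = f (inv_into UNIV f u) @ [n])"
      using f unfolding tree_aut_group_def by simp
    then show ?thesis by (simp only: r)
  qed
  ultimately have "inv_into UNIV f \<in> carrier tree_aut_group"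
    using b by (simp add: tree_aut_group_def bij_imp_bij_inv)
  moreover have "inv_into UNIV f \<otimes>\<^bsub>tree_aut_group\<^esub> f = \<one>\<^bsub>tree_aut_group\<^esub>"
    using b by (simp add: tree_aut_group_def bij_is_inj)
  ultimately show "\<exists>g \<in> carrier tree_aut_group. g \<otimes>\<^bsub>tree_aut_group\<^esub> f = \<one>\<^bsub>tree_aut_group\<^esub>"
    by blast
qed (auto simp: tree_aut_group_def)

lemma length_act [simp]: "length (act xs ys q v) = length v"
  by (induction v arbitrary: q) auto

lemma bij_fst_tau: "bij (\<lambda>z. fst (tau xs ys q z))"
proof (cases "q = StateA 0")
  case True
  then show ?thesis by (simp add: bij_plus_right)
next
  case False
  then have "fst (tau xs ys q z) = z" for z
    by (cases "(xs, ys, q, z)" rule: tau.cases) auto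
  then show ?thesis by (simp add: id_def[symmetric])
qed

lemma inj_act: "act xs ys q u = act xs ys q v \<Longrightarrow> u = v"
proof (induction u arbitrary: q v)
  case Nil
  then show ?case by (cases v) auto
next
  case (Cons z u)
  then show ?case
    using bij_is_inj[OF bij_fst_tau[of xs ys q]] by (cases v) (auto simp: inj_eq dest: injD)
qed

lemma surj_act: "\<exists>u. act xs ys q u = v"
proof (induction v arbitrary: q)
  case Nil
  then show ?case by (rule exI[of _ "[]"]) simp
next
  case (Cons z v)
  obtain z' where "fst (tau xs ys q z') = z"
    using bij_is_surj[OF bij_fst_tau[of xs ys q]] by (metis surjD)
  moreover obtain u where "act xs ys (snd (tau xs ys q z')) u = v"
    using Cons by blast
  ultimately show ?case by (intro exI[of _ "z' # u"]) simp
qed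

lemma act_append: "\<exists>n'. act xs ys q (u @ [n]) = act xs ys q u @ [n']"
  by (induction u arbitrary: q) auto

lemma act_in_tree_aut_group: "act xs ys q \<in> carrier tree_aut_group"
proof -
  have "\<exists>n. v = u @ [n]" if e: "act xs ys q v = act xs ys q u @ [n]" for u v n
  proof -
    have "v \<noteq> []" using e by auto
    then obtain w m where v: "v = w @ [m]" by (metis rev_exhaust)
    then have "act xs ys q w = act xs ys q u"
      using e act_append[of xs ys q w m] by auto
    then show ?thesis using v inj_act by blast
  qed
  then have "(\<exists>n. v = u @ [n]) \<longleftrightarrow> (\<exists>n. act xs ys q v = act xs ys q u @ [n])" for u v
    using act_append by metis
  moreover have "bij (act xs ys q)"
    unfolding bij_def inj_def surj_def using inj_act surj_act by metis
  ultimately show ?thesis by (simp add: tree_aut_group_def)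
qed

lemma group_kneading_group: "group (kneading_group xs ys)"
  unfolding kneading_group_def
  by (intro subgroup.subgroup_is_group group.generate_is_subgroup group_tree_aut_group)
     (auto simp: act_in_tree_aut_group)

end

theory Submission imports Defs begin

text \<open>
  In a residually finite group the centralizer of an element \<open>g\<close> is closed in the profinite
  topology, and \<open>a ^ n\<close> is trivial in a given finite quotient for arbitrarily large \<open>n\<close>. Hence,
  if \<open>g\<close> commutes with the conjugates of \<open>h\<close> by all large powers of \<open>a\<close>, then \<open>g\<close> commutes
  with \<open>h\<close> itself (lemma \<open>residually_finite_commute\<close>).

  Take for \<open>a\<close> the state \<open>a\<^sub>1\<close>, which translates the first letter. An element that fixes the first
  level and acts nontrivially below only finitely many letters commutes, for disjointness of supports,
  with every far enough translate of another such element. So if the group were residually finite,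
  all these finitely supported elements would commute with each other (lemma
  \<open>residually_finite_commute_supported\<close>). But among them, some element acts as \<open>a\<^sub>1\<close> below a letter,
  namely \<open>a\<^sub>2\<close> or, if there is no \<open>a\<^sub>2\<close>, \<open>b\<^sub>1\<close>. Some element likewise acts as \<open>b\<^sub>1\<close> below a
  letter, namely \<open>b\<^sub>2\<close> or, if there is no \<open>b\<^sub>2\<close>, \<open>b\<^sub>1\<close>; this is where \<open>last xs \<noteq> last ys\<close>
  enters. After a translation the two letters agree, so \<open>a\<^sub>1\<close> and \<open>b\<^sub>1\<close> would commute. This is
  absurd: the set of letters below which \<open>b\<^sub>1\<close> is nontrivial would be invariant under translation,
  yet it is finite, and it contains \<open>last xs\<close> because \<open>a\<^sub>k\<close> is nontrivial.
\<close>

section \<open>Centralizers in residually finite groups\<close>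

text \<open>
  In a finite quotient of order \<open>m\<close>, the image of \<open>h\<close> is also the image of its conjugate by
  \<open>a ^ n\<close> whenever \<open>m\<close> divides \<open>n\<close>. Choosing such an \<open>n \<ge> n0\<close> shows that the commutator of
  \<open>g\<close> and \<open>h\<close> dies in every finite quotient.
\<close>

lemma residually_finite_commute:
  fixes G (structure)
  assumes rf: "residually_finite G"
    and a: "a \<in> carrier G" and g: "g \<in> carrier G" and h: "h \<in> carrier G"
    and comm: "\<And>n::nat. n \<ge> n0 \<Longrightarrow>
      g \<otimes> (a [^] n \<otimes> h \<otimes> inv (a [^] n)) = (a [^] n \<otimes> h \<otimes> inv (a [^] n)) \<otimes> g"
  shows "g \<otimes> h = h \<otimes> g"
proof (rule ccontr)
  assume ne: "g \<otimes> h \<noteq> h \<otimes> g"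
  interpret group G using rf by (simp add: residually_finite_def)
  define c where "c = (g \<otimes> h) \<otimes> inv (h \<otimes> g)"
  have c: "c \<in> carrier G" using g h by (simp add: c_def)
  have "c \<noteq> \<one>"
    using ne g h inv_solve_right[of \<one> "g \<otimes> h" "h \<otimes> g"] by (auto simp: c_def)
  then obtain N where N: "N \<lhd> G" and fin: "finite (rcosets N)" and cN: "c \<notin> N"
    using rf c unfolding residually_finite_def by blast
  interpret N: normal N G by (fact N)
  interpret Q: group "G Mod N" by (fact N.factorgroup_is_group)
  interpret \<pi>: group_hom G "G Mod N" "(#>) N"
    by unfold_locales (rule N.r_coset_hom_Mod)
  define m where "m = order (G Mod N)"
  \<comment> \<open>Not automatic: an infinite quotient would have \<open>order\<close> zero.\<close>
  have "m > 0"
    using fin by (simp add: m_def order_def FactGroup_def card_gt_0_iff rcosets_part_G[symmetric])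
      (metis Q.one_closed empty_iff FactGroup_def partial_object.select_convs(1))
  \<comment> \<open>A multiple of the order of the quotient that is at least \<open>n0\<close>.\<close>
  define n where "n = m * n0"
  define k where "k = a [^] n \<otimes> h \<otimes> inv (a [^] n)"
  have "n \<ge> n0" using \<open>m > 0\<close> by (simp add: n_def)
  have k: "k \<in> carrier G" using a h by (simp add: k_def)
  have "N #> (a [^] n) = (N #> a) [^]\<^bsub>G Mod N\<^esub> n"
    using a by (rule \<pi>.hom_nat_pow)
  also have "\<dots> = ((N #> a) [^]\<^bsub>G Mod N\<^esub> m) [^]\<^bsub>G Mod N\<^esub> n0"
    using a by (simp add: n_def Q.nat_pow_pow)
  also have "\<dots> = \<one>\<^bsub>G Mod N\<^esub>"
    using Q.pow_order_eq_1[OF \<pi>.hom_closed[OF a]] by (simp only: m_def Q.nat_pow_one)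
  finally have "N #> (a [^] n) = \<one>\<^bsub>G Mod N\<^esub>" .
  then have "N #> k = N #> h"
    using a h \<pi>.hom_closed[OF h] by (simp add: k_def del: one_FactGroup mult_FactGroup)
  moreover have "g \<otimes> k = k \<otimes> g"
    using comm[OF \<open>n \<ge> n0\<close>] by (simp add: k_def)
  ultimately have "N #> (g \<otimes> h) = N #> (h \<otimes> g)"
    using g h k by (metis \<pi>.hom_mult)
  moreover have "N #> c = (N #> (g \<otimes> h)) \<otimes>\<^bsub>G Mod N\<^esub> inv\<^bsub>G Mod N\<^esub> (N #> (h \<otimes> g))"
    using g h by (simp only: c_def \<pi>.hom_mult[of "g \<otimes> h"] \<pi>.hom_inv inv_closed m_closed)
  ultimately have "N #> c = \<one>\<^bsub>G Mod N\<^esub>"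
    using g h by (simp only: Q.r_inv \<pi>.hom_closed m_closed)
  then show False
    using c cN rcos_self[OF c N.is_subgroup] by (simp add: FactGroup_def)
qed

section \<open>Translations and finitely supported maps\<close>

text \<open>The integer powers of \<open>a\<^sub>1\<close>.\<close>

fun translate :: "int \<Rightarrow> int list \<Rightarrow> int list" where
  "translate n [] = []"
| "translate n (z # v) = (z + n) # v"

lemma translate_translate [simp]: "translate m (translate n v) = translate (m + n) v"
  by (cases v) auto

lemma translate_0 [simp]: "translate 0 v = v"
  by (cases v) auto

lemma translate_eq_iff: "translate n u = v \<longleftrightarrow> u = translate (- n) v"
  by auto

lemma act_Trivial: "act xs ys Trivial v = v"
  by (induction v) auto

lemma act_StateA_0: "act xs ys (StateA 0) = translate 1"
proof
  fix v show "act xs ys (StateA 0) v = translate 1 v" by (cases v) (auto simp: act_Trivial)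
qed

definition letter_support :: "(int list \<Rightarrow> int list) \<Rightarrow> int set" where
  "letter_support f = {z. \<exists>v. f (z # v) \<noteq> z # v}"

definition finitely_supported :: "(int list \<Rightarrow> int list) \<Rightarrow> bool" where
  "finitely_supported f \<longleftrightarrow>
     f [] = [] \<and> (\<forall>z v. \<exists>w. f (z # v) = z # w) \<and> finite (letter_support f)"

lemma disjoint_support_commute:
  assumes f: "finitely_supported f" and g: "finitely_supported g"
    and disj: "letter_support f \<inter> letter_support g = {}"
  shows "f \<circ> g = g \<circ> f"
proof
  fix u show "(f \<circ> g) u = (g \<circ> f) u"
  proof (cases u)
    case Nil
    then show ?thesis using f g by (simp add: finitely_supported_def)
  next
    case (Cons z v)
    obtain w w' where "f (z # v) = z # w" "g (z # v) = z # w'"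
      using f g unfolding finitely_supported_def by blast
    moreover have "(\<forall>v. f (z # v) = z # v) \<or> (\<forall>v. g (z # v) = z # v)"
      using disj unfolding letter_support_def by blast
    ultimately show ?thesis using Cons by auto
  qed
qed

lemma letter_support_conj_translate:
  "letter_support (translate n \<circ> f \<circ> translate (- n)) = (\<lambda>z. z + n) ` letter_support f"
proof -
  have "z \<in> letter_support (translate n \<circ> f \<circ> translate (- n)) \<longleftrightarrow> z - n \<in> letter_support f" for z
    by (auto simp: letter_support_def translate_eq_iff)
  moreover have "z - n \<in> letter_support f \<longleftrightarrow> z \<in> (\<lambda>z. z + n) ` letter_support f" for z
    by (auto intro: image_eqI[of z _ "z - n"])
  ultimately show ?thesis by (simp only: set_eq_iff simp_thms)
qed

lemma finitely_supported_conj_translate: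
  assumes f: "finitely_supported f"
  shows "finitely_supported (translate n \<circ> f \<circ> translate (- n))"
proof -
  have "\<exists>w. (translate n \<circ> f \<circ> translate (- n)) (z # v) = z # w" for z v
  proof -
    obtain w where "f ((z - n) # v) = (z - n) # w"
      using f unfolding finitely_supported_def by blast
    then show ?thesis by auto
  qed
  then show ?thesis
    using f unfolding finitely_supported_def letter_support_conj_translate by auto
qed

lemma eventually_disjoint_translates:
  fixes S T :: "int set"
  assumes "finite S" "finite T"
  shows "\<exists>n0. \<forall>n\<ge>n0. S \<inter> (\<lambda>z. z + int n) ` T = {}"
proof -
  let ?D = "(\<lambda>(s, t). s - t) ` (S \<times> T)"
  define n0 where "n0 = Suc (nat (Max (insert 0 ?D)))"
  have "s \<noteq> t + int n" if "n \<ge> n0" "s \<in> S" "t \<in> T" for n s t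
  proof -
    have "s - t \<le> Max (insert 0 ?D)"
      using assms that by (intro Max_ge) auto
    then show ?thesis using that(1) unfolding n0_def by linarith
  qed
  then have "\<forall>n\<ge>n0. S \<inter> (\<lambda>z. z + int n) ` T = {}" by auto
  then show ?thesis by (rule exI)
qed

text \<open>
  Commuting with the translation makes the support translation invariant, and a finite
  translation invariant set of integers is empty.
\<close>

lemma finitely_supported_commute_translate:
  assumes f: "finitely_supported f" and comm: "\<And>v. f (translate 1 v) = translate 1 (f v)"
  shows "f v = v"
proof -
  have step: "z + 1 \<in> letter_support f" if z: "z \<in> letter_support f" for z
  proof -
    obtain v where v: "f (z # v) \<noteq> z # v"
      using z unfolding letter_support_def by blast
    have "f ((z + 1) # v) \<noteq> (z + 1) # v"
      using comm[of "z # v"] v by (auto simp: translate_eq_iff dest: sym)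
    then show ?thesis unfolding letter_support_def by blast
  qed
  have "letter_support f = {}"
  proof (rule ccontr)
    assume ne: "letter_support f \<noteq> {}"
    have fin: "finite (letter_support f)" using f by (simp add: finitely_supported_def)
    then have "Max (letter_support f) + 1 \<in> letter_support f"
      using ne by (intro step Max_in)
    then have "Max (letter_support f) + 1 \<le> Max (letter_support f)"
      using fin by (rule Max_ge[rotated])
    then show False by simp
  qed
  then show ?thesis
    using f by (cases v) (auto simp: finitely_supported_def letter_support_def)
qed

section \<open>The kneading group\<close>

lemma kneading_group_simps:
  "monoid.mult (kneading_group xs ys) = (\<circ>)" "one (kneading_group xs ys) = id"
  by (simp_all add: kneading_group_def tree_aut_group_def)

lemma act_in_kneading_group:
  "q \<in> kneading_states xs ys \<Longrightarrow> act xs ys q \<in> carrier (kneading_group xs ys)"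
  by (simp add: kneading_group_def generate.incl)

lemma inv_translate:
  assumes t: "translate n \<in> carrier (kneading_group xs ys)"
  shows "inv\<^bsub>kneading_group xs ys\<^esub> (translate n) = translate (- n)"
proof -
  let ?i = "inv\<^bsub>kneading_group xs ys\<^esub> (translate n)"
  have "?i \<circ> translate n = id"
    using group.l_inv[OF group_kneading_group t] by (simp add: kneading_group_simps)
  then have "?i (translate n (translate (- n) v)) = translate (- n) v" for v
    by (metis comp_apply id_apply)
  then show ?thesis by auto
qed

lemma pow_translate:
  "translate 1 [^]\<^bsub>kneading_group xs ys\<^esub> (n::nat) = translate (int n)"
proof (induction n)
  case 0
  then show ?case by (auto simp: kneading_group_simps)
next
  case (Suc n)
  then show ?case by (auto simp: kneading_group_simps add.commute)
qed

lemma translate_in_kneading_group: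
  assumes "xs \<noteq> []"
  shows "translate n \<in> carrier (kneading_group xs ys)"
proof -
  interpret group "kneading_group xs ys" by (rule group_kneading_group)
  have "translate 1 \<in> carrier (kneading_group xs ys)"
    using act_in_kneading_group[of "StateA 0" xs ys] assms
    by (auto simp: act_StateA_0 kneading_states_def)
  then have nat: "translate (int m) \<in> carrier (kneading_group xs ys)" for m
    using nat_pow_closed pow_translate by metis
  then have "translate (- int m) \<in> carrier (kneading_group xs ys)" for m
    using inv_closed inv_translate by metis
  with nat show ?thesis by (metis int_cases2)
qed

text \<open>
  Conjugating \<open>h\<close> by a large power of \<open>a\<^sub>1\<close> moves its support away from the support of \<open>g\<close>, so
  that the closedness of the centralizer of \<open>g\<close> applies.
\<close>

lemma residually_finite_commute_supported:
  assumes rf: "residually_finite (kneading_group xs ys)" and xs: "xs \<noteq> []"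
    and g: "g \<in> carrier (kneading_group xs ys)" "finitely_supported g"
    and h: "h \<in> carrier (kneading_group xs ys)" "finitely_supported h"
  shows "g \<circ> h = h \<circ> g"
proof -
  let ?G = "kneading_group xs ys"
  have tr: "translate n \<in> carrier ?G" for n
    using xs by (rule translate_in_kneading_group)
  obtain n0 where
    n0: "\<And>n. n \<ge> n0 \<Longrightarrow> letter_support g \<inter> (\<lambda>z. z + int n) ` letter_support h = {}"
    using eventually_disjoint_translates[of "letter_support g" "letter_support h"] g h
    unfolding finitely_supported_def by blast
  have "g \<otimes>\<^bsub>?G\<^esub> h = h \<otimes>\<^bsub>?G\<^esub> g"
  proof (rule residually_finite_commute[OF rf tr[of 1] g(1) h(1)])
    fix n assume "n \<ge> n0"
    then have "g \<circ> (translate (int n) \<circ> h \<circ> translate (- int n)) =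
        (translate (int n) \<circ> h \<circ> translate (- int n)) \<circ> g"
      by (intro disjoint_support_commute finitely_supported_conj_translate g h)
         (simp add: letter_support_conj_translate n0)
    then show "g \<otimes>\<^bsub>?G\<^esub> (translate 1 [^]\<^bsub>?G\<^esub> n \<otimes>\<^bsub>?G\<^esub> h \<otimes>\<^bsub>?G\<^esub> inv\<^bsub>?G\<^esub> (translate 1 [^]\<^bsub>?G\<^esub> n)) =
        translate 1 [^]\<^bsub>?G\<^esub> n \<otimes>\<^bsub>?G\<^esub> h \<otimes>\<^bsub>?G\<^esub> inv\<^bsub>?G\<^esub> (translate 1 [^]\<^bsub>?G\<^esub> n) \<otimes>\<^bsub>?G\<^esub> g"
      by (simp only: pow_translate inv_translate[OF tr] kneading_group_simps)
  qed
  then show ?thesis by (simp add: kneading_group_simps)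
qed

lemma finitely_supported_act:
  assumes "q \<noteq> StateA 0"
  shows "finitely_supported (act xs ys q)"
proof -
  have fst: "fst (tau xs ys q z) = z" for z
    using assms by (cases "(xs, ys, q, z)" rule: tau.cases) auto
  have "finite {z. snd (tau xs ys q z) \<noteq> Trivial}"
  proof (cases q)
    case (StateA i)
    then obtain j where "q = StateA (Suc j)" using assms by (cases i) auto
    then show ?thesis by (auto intro: finite_subset[of _ "{xs ! j}"] split: if_splits)
  next
    case (StateB i)
    then show ?thesis
      by (cases i) (auto intro: finite_subset[of _ "{last xs, last ys, ys ! (i - 1)}"] split: if_splits)
  qed simp
  moreover have "letter_support (act xs ys q) \<subseteq> {z. snd (tau xs ys q z) \<noteq> Trivial}"
    by (auto simp: letter_support_def fst act_Trivial)
  ultimately show ?thesis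
    unfolding finitely_supported_def by (auto simp: fst intro: finite_subset)
qed

lemma act_StateA_nontrivial: "\<exists>v. act xs ys (StateA i) v \<noteq> v"
proof (induction i)
  case 0
  have "act xs ys (StateA 0) [0] \<noteq> [0]" by simp
  then show ?case by blast
next
  case (Suc i)
  then obtain v where "act xs ys (StateA i) v \<noteq> v" by blast
  then have "act xs ys (StateA (Suc i)) (xs ! i # v) \<noteq> xs ! i # v" by simp
  then show ?case by blast
qed

lemma act_StateB_0_not_commute_translate:
  "\<exists>v. act xs ys (StateB 0) (translate 1 v) \<noteq> translate 1 (act xs ys (StateB 0) v)"
proof (rule ccontr)
  assume "\<not> ?thesis"
  then have "act xs ys (StateB 0) (translate 1 v) = translate 1 (act xs ys (StateB 0) v)" for v
    by blast
  then have triv: "act xs ys (StateB 0) v = v" for v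
    by (rule finitely_supported_commute_translate[OF finitely_supported_act, rotated]) simp_all
  obtain v where "act xs ys (StateA (length xs - 1)) v \<noteq> v"
    using act_StateA_nontrivial by blast
  then show False
    using triv[of "last xs # v"] by simp
qed

text \<open>
  The next two lemmas find copies of \<open>a\<^sub>1\<close> and \<open>b\<^sub>1\<close> among the sections of the finitely
  supported generators, by following the arrows of the automaton backwards. The only arrow into
  \<open>a\<^sub>1\<close> comes from \<open>a\<^sub>2\<close> if \<open>k > 1\<close>, and from \<open>b\<^sub>1\<close> otherwise. The only arrow into \<open>b\<^sub>1\<close> comes
  from \<open>b\<^sub>2\<close> if \<open>p > 1\<close>, and otherwise it is the loop of \<open>b\<^sub>1\<close> at \<open>last ys\<close>, which exists
  because that letter is not already used by the arrow into \<open>a\<^sub>k\<close>.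
\<close>

lemma exists_section_StateA_0:
  assumes "xs \<noteq> []" "ys \<noteq> []"
  shows "\<exists>q\<in>kneading_states xs ys. q \<noteq> StateA 0 \<and>
    (\<exists>z. \<forall>v. act xs ys q (z # v) = z # act xs ys (StateA 0) v)"
proof (cases "length xs = 1")
  case True
  then have "act xs ys (StateB 0) (last xs # v) = last xs # act xs ys (StateA 0) v" for v
    by simp
  then show ?thesis
    using assms unfolding kneading_states_def by (intro bexI[of _ "StateB 0"]) blast+
next
  case False
  then have "Suc 0 < length xs" using assms(1) by (cases xs) auto
  moreover have "act xs ys (StateA (Suc 0)) (xs ! 0 # v) = xs ! 0 # act xs ys (StateA 0) v" for v
    by simp
  ultimately show ?thesis
    unfolding kneading_states_def by (intro bexI[of _ "StateA (Suc 0)"]) blast+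
qed

lemma exists_section_StateB_0:
  assumes "ys \<noteq> []" "last xs \<noteq> last ys"
  shows "\<exists>q\<in>kneading_states xs ys. q \<noteq> StateA 0 \<and>
    (\<exists>z. \<forall>v. act xs ys q (z # v) = z # act xs ys (StateB 0) v)"
proof (cases "length ys = 1")
  case True
  then have "act xs ys (StateB 0) (last ys # v) = last ys # act xs ys (StateB 0) v" for v
    using assms(2) by simp
  then show ?thesis
    using assms(1) unfolding kneading_states_def by (intro bexI[of _ "StateB 0"]) blast+
next
  case False
  then have "Suc 0 < length ys" using assms(1) by (cases ys) auto
  moreover have "act xs ys (StateB (Suc 0)) (ys ! 0 # v) = ys ! 0 # act xs ys (StateB 0) v" for v
    by simp
  ultimately show ?thesis
    unfolding kneading_states_def by (intro bexI[of _ "StateB (Suc 0)"]) blast+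
qed

theorem lemma6p4:
  fixes xs ys :: "int list"
  assumes "length xs \<ge> 1" and "length ys \<ge> 1"
    and "last xs \<noteq> last ys"
  shows "\<not> residually_finite (kneading_group xs ys)"
proof
  assume rf: "residually_finite (kneading_group xs ys)"
  let ?G = "kneading_group xs ys"
  interpret group ?G by (rule group_kneading_group)
  have xs: "xs \<noteq> []" and ys: "ys \<noteq> []" using assms by auto
  let ?b = "act xs ys (StateB 0)"
  obtain q x where q: "q \<in> kneading_states xs ys" "q \<noteq> StateA 0"
    and g: "\<And>v. act xs ys q (x # v) = x # translate 1 v"
    using exists_section_StateA_0[OF xs ys] unfolding act_StateA_0 by blast
  obtain r y where r: "r \<in> kneading_states xs ys" "r \<noteq> StateA 0"
    and h: "\<And>v. act xs ys r (y # v) = y # ?b v"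
    using exists_section_StateB_0[OF ys assms(3)] by blast
  \<comment> \<open>Conjugation by this translation moves the letter \<open>y\<close> to the letter \<open>x\<close>.\<close>
  define h' where "h' = translate (x - y) \<circ> act xs ys r \<circ> translate (- (x - y))"
  have h': "h' (x # v) = x # ?b v" for v
    by (simp add: h'_def h del: act.simps)
  have "h' \<in> carrier ?G"
    using m_closed[OF m_closed[OF translate_in_kneading_group[OF xs] act_in_kneading_group[OF r(1)]]
        translate_in_kneading_group[OF xs]]
    by (simp add: h'_def kneading_group_simps)
  then have "act xs ys q \<circ> h' = h' \<circ> act xs ys q"
    unfolding h'_def using q r
    by (intro residually_finite_commute_supported[OF rf xs] act_in_kneading_group
        finitely_supported_act finitely_supported_conj_translate)
  then have "act xs ys q (h' (x # v)) = h' (act xs ys q (x # v))" for v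
    by (metis comp_apply)
  then have "translate 1 (?b v) = ?b (translate 1 v)" for v
    by (simp add: g h' del: act.simps)
  then show False
    using act_StateB_0_not_commute_translate[of xs ys] by metis
qed

end
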